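(* For every random variable $X\in L$ and every real $\delta>0$, $$P(0<X<\delta)\ \ge\ \frac{\delta}{72(1+c\delta)},\qquad\text{where } c:=\frac{419}{100}.$$
   Context: $L$ denotes the set of all real-valued random variables $X$ that have a log-concave probability density function $f_X$ on $\mathbb{R}$ (that is, $f_X((1-t)x+ty)\ge f_X(x)^{1-t}f_X(y)^t$ for all real $x,y$ and all $t\in(0,1)$) and satisfy $EX=0$ and $EX^2=1$. *)

theory Defs
  imports "HOL-Probability.Probability"
begin

(* Nonnegativity is part of the notion: powr on reals has the intended meaning only for
   nonnegative bases. Since 0 powr a = 0, the inequality is trivial where f x = 0 or f y = 0. *)
definition log_concave :: "(real \<Rightarrow> real) \<Rightarrow> bool" where
  "log_concave f \<longleftrightarrow>
     (\<forall>x. 0 \<le> f x) \<and>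
     (\<forall>x y t. 0 < t \<and> t < 1 \<longrightarrow>
        f ((1 - t) * x + t * y) \<ge> f x powr (1 - t) * f y powr t)"

(* Membership of X in L, for a random variable X on the probability space M. Integrability is
   stated explicitly because the Bochner integral of a non-integrable function is 0 by convention. *)
definition in_L :: "'a measure \<Rightarrow> ('a \<Rightarrow> real) \<Rightarrow> bool" where
  "in_L M X \<longleftrightarrow>
     prob_space M \<and>
     (\<exists>f. log_concave f \<and> distributed M lborel X (\<lambda>x. ennreal (f x))) \<and>
     integrable M X \<and> integral\<^sup>L M X = 0 \<and>
     integrable M (\<lambda>\<omega>. (X \<omega>)\<^sup>2) \<and> integral\<^sup>L M (\<lambda>\<omega>. (X \<omega>)\<^sup>2) = 1"

end

theory Submission
  imports Defs
begin

text \<open>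
  Let \<open>f\<close> be the density. Two facts about \<open>f\<close> on the scale of the standard deviation carry the
  bound, and log-concavity then transfers them to intervals of every length \<open>\<delta>\<close>.

  The first fact is Gruenbaum's inequality: each side of the mean has mass at least \<open>1/e\<close>, hence at
  least \<open>1/3\<close> (\<open>centred_log_concave_mass_right_ge\<close>, applied to \<open>f\<close> and to its reflection). It is
  proved by comparing \<open>f\<close> with the exponential function through \<open>(0, f 0)\<close> that has the same mass
  \<open>p\<close> on the positive half-line. With
  \<open>T = p / f 0\<close>, integrating \<open>x + T\<close> against \<open>f\<close> gives \<open>T\<close> because the mean is zero, whereas
  integrating it against the exponential over \<open>[-T, \<infinity>)\<close> gives \<open>p e T\<close>; the way in which the two
  functions cross makes the latter at least the former. The second fact is Chebyshev's inequality:
  the mass outside \<open>(-2, 2)\<close> is at most \<open>1/4\<close>. Together they leave mass at least \<open>1/12\<close> on each of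
  \<open>[0, 2)\<close> and \<open>[-2, 0)\<close>.

  For given \<open>\<delta>\<close> (\<open>log_concave_interval_mass_ge\<close>), suppose first that \<open>f \<delta> \<le> f 0\<close>. Then
  \<open>f (x + \<delta>) \<le> f x\<close> for all \<open>x \<ge> 0\<close>, so the successive intervals of length \<open>\<delta>\<close> have decreasing
  masses, and the first of about \<open>2/\<delta>\<close> intervals that cover \<open>[0, 2)\<close> carries its share of \<open>1/12\<close>.
  If \<open>f \<delta> > f 0\<close>, then \<open>f\<close> is at most \<open>f 0\<close> on the left, so the mass of \<open>[-2, 0)\<close> forces
  \<open>f 0 \<ge> 1/24\<close>; and \<open>f\<close> is at least \<open>f 0\<close> on \<open>[0, \<delta>)\<close>. In both cases the mass of \<open>[0, \<delta>)\<close> is at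
  least \<open>\<delta> / (12 (2 + \<delta>))\<close>, which exceeds the claimed bound.
\<close>

section \<open>Log-concave functions on the line\<close>

lemma log_concave_nonneg: "log_concave f \<Longrightarrow> 0 \<le> f x"
  by (simp add: log_concave_def)

lemma log_concave_between:
  assumes "log_concave f" "a < b" "b < c"
  obtains t where "0 < t" "t < 1" "b = (1 - t) * a + t * c"
    "f a powr (1 - t) * f c powr t \<le> f b"
proof -
  define t where "t = (b - a) / (c - a)"
  have t: "0 < t" "t < 1" using assms by (auto simp: t_def field_simps)
  have "t * (c - a) = b - a" using assms by (simp add: t_def)
  hence b: "b = (1 - t) * a + t * c" by (simp add: algebra_simps)
  show ?thesis
    by (rule that[OF t b]) (use assms(1) t in \<open>auto simp: log_concave_def b\<close>)
qed

lemma weighted_geometric_mean_ge: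
  fixes u v m t :: real
  assumes "0 < t" "t < 1" "0 \<le> m" "m \<le> u" "m \<le> v"
  shows "m \<le> u powr (1 - t) * v powr t"
proof (cases "m = 0")
  case False
  have "m = m powr (1 - t) * m powr t"
    using assms False by (simp flip: powr_add)
  also have "\<dots> \<le> u powr (1 - t) * v powr t"
    using assms by (intro mult_mono powr_mono2) auto
  finally show ?thesis .
qed auto

lemma log_concave_quasiconcave:
  assumes "log_concave f" "a \<le> b" "b \<le> c" "m \<le> f a" "m \<le> f c"
  shows "m \<le> f b"
proof (cases "0 \<le> m \<and> a < b \<and> b < c")
  case True
  then obtain t where "0 < t" "t < 1" "f a powr (1 - t) * f c powr t \<le> f b"
    using log_concave_between[OF assms(1)] by metis
  thus ?thesis
    using weighted_geometric_mean_ge[of t m "f a" "f c"] True assms by force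
next
  case False
  thus ?thesis using assms log_concave_nonneg[OF assms(1), of b] by force
qed

text \<open>
  If \<open>f a\<close> exceeded \<open>f b\<close>, the weighted geometric mean of \<open>f a\<close> and \<open>f c\<close> would exceed \<open>f b\<close>.
  Positivity of \<open>f b\<close> is essential: if \<open>f\<close> vanishes at both \<open>b\<close> and \<open>c\<close>, the value \<open>f a\<close> is
  unconstrained.
\<close>
lemma log_concave_le_before_rise:
  assumes lc: "log_concave f" and "a < b" "b < c" "0 < f b" "f b \<le> f c"
  shows "f a \<le> f b"
proof (rule ccontr)
  assume "\<not> f a \<le> f b"
  obtain t where t: "0 < t" "t < 1" and le: "f a powr (1 - t) * f c powr t \<le> f b"
    using log_concave_between[OF lc \<open>a < b\<close> \<open>b < c\<close>] by metis
  have "f b = f b powr (1 - t) * f b powr t"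
    using assms by (simp flip: powr_add)
  also have "\<dots> < f a powr (1 - t) * f c powr t"
    using assms t \<open>\<not> f a \<le> f b\<close>
    by (intro mult_less_le_imp_less powr_less_mono2 powr_mono2) auto
  finally show False using le by simp
qed

text \<open>
  The inner points \<open>x + h\<close> and \<open>y\<close> divide the segment from \<open>x\<close> to \<open>y + h\<close> in complementary
  proportions, so the exponents in the two log-concavity inequalities add up to one when these are
  multiplied. For positive \<open>f\<close> this says that \<open>f (x + h) / f x\<close> decreases in \<open>x\<close>.
\<close>
lemma log_concave_exchange:
  assumes lc: "log_concave f" and "x \<le> y" "0 \<le> h"
  shows "f x * f (y + h) \<le> f (x + h) * f y"
proof (cases "x < y \<and> 0 < h")
  case True
  define s where "s = h / (y + h - x)"
  have s: "0 < s" "s < 1" using True by (auto simp: s_def field_simps)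
  have "s * (y + h - x) = h" using True by (simp add: s_def)
  hence 1: "x + h = (1 - s) * x + s * (y + h)" and 2: "y = s * x + (1 - s) * (y + h)"
    by (simp_all add: algebra_simps)
  have nn: "0 \<le> f x" "0 \<le> f (y + h)" using lc by (auto simp: log_concave_def)
  have conc: "f x powr (1 - t) * f (y + h) powr t \<le> f ((1 - t) * x + t * (y + h))"
    if "0 < t" "t < 1" for t using lc that unfolding log_concave_def by blast
  have a: "f x powr (1 - s) * f (y + h) powr s \<le> f (x + h)"
    using conc[of s] s by (simp flip: 1)
  have b: "f x powr s * f (y + h) powr (1 - s) \<le> f y"
    using conc[of "1 - s"] s by (simp flip: 2)
  have "f x * f (y + h) = (f x powr (1 - s) * f x powr s) * (f (y + h) powr s * f (y + h) powr (1 - s))"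
    using nn by (simp flip: powr_add)
  also have "\<dots> = (f x powr (1 - s) * f (y + h) powr s) * (f x powr s * f (y + h) powr (1 - s))"
    by (simp add: mult_ac)
  also have "\<dots> \<le> f (x + h) * f y"
    using a b lc by (intro mult_mono) (auto simp: log_concave_def)
  finally show ?thesis .
next
  case False
  hence "x = y \<or> h = 0" using assms by auto
  thus ?thesis by (auto simp: mult_ac)
qed

text \<open>
  This turns a comparison of \<open>f\<close> with an exponential into a comparison of a log-concave function
  with a constant.
\<close>
lemma log_concave_exp_tilt:
  assumes "log_concave f"
  shows "log_concave (\<lambda>x. f x * exp (l * x))"
  unfolding log_concave_def
proof (intro conjI allI impI)
  fix x y t :: real
  assume t: "0 < t \<and> t < 1"
  have "(f x * exp (l * x)) powr (1 - t) * (f y * exp (l * y)) powr t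
      = (f x powr (1 - t) * f y powr t) * (exp ((l * x) * (1 - t)) * exp ((l * y) * t))"
    using assms by (simp add: powr_mult log_concave_def exp_powr_real mult_ac)
  also have "exp ((l * x) * (1 - t)) * exp ((l * y) * t) = exp (l * ((1 - t) * x + t * y))"
    by (simp add: algebra_simps flip: exp_add)
  also have "(f x powr (1 - t) * f y powr t) * \<dots> \<le> f ((1 - t) * x + t * y) * \<dots>"
    using assms t by (intro mult_right_mono) (auto simp: log_concave_def)
  finally show "(f x * exp (l * x)) powr (1 - t) * (f y * exp (l * y)) powr t
      \<le> f ((1 - t) * x + t * y) * exp (l * ((1 - t) * x + t * y))" .
qed (use assms in \<open>auto simp: log_concave_def\<close>)

lemma log_concave_reflect:
  assumes "log_concave f"
  shows "log_concave (\<lambda>x. f (- x))"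
  unfolding log_concave_def
proof (intro conjI allI impI)
  fix x y t :: real
  assume t: "0 < t \<and> t < 1"
  have "- ((1 - t) * x + t * y) = (1 - t) * (- x) + t * (- y)" by (simp add: algebra_simps)
  thus "f (- x) powr (1 - t) * f (- y) powr t \<le> f (- ((1 - t) * x + t * y))"
    using assms t unfolding log_concave_def by metis
qed (use assms in \<open>auto simp: log_concave_def\<close>)

section \<open>Mass on either side of the mean\<close>

lemma exponential_moments:
  assumes "0 < l"
  shows "has_bochner_integral lborel (exponential_density l) 1"
    and "has_bochner_integral lborel (\<lambda>x. x * exponential_density l x) (1 / l)"
proof -
  have *: "has_bochner_integral lborel (\<lambda>x. exponential_density l x * x ^ i) (fact i / l ^ i)" for i
  proof (rule has_bochner_integral_nn_integral)
    show "AE x in lborel. 0 \<le> exponential_density l x * x ^ i"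
      using assms by (auto simp: exponential_density_def)
    show "(\<integral>\<^sup>+ x. ennreal (exponential_density l x * x ^ i) \<partial>lborel) = ennreal (fact i / l ^ i)"
      using nn_integral_erlang_ith_moment[OF assms, of 0 i] by simp
  qed (use assms in auto)
  show "has_bochner_integral lborel (exponential_density l) 1" using *[of 0] by simp
  show "has_bochner_integral lborel (\<lambda>x. x * exponential_density l x) (1 / l)"
    using *[of 1] by (simp add: mult.commute)
qed

text \<open>
  Otherwise \<open>x f(x)\<close> has one sign and integral zero, which makes \<open>f\<close> vanish almost everywhere.
\<close>
lemma centred_density_mass_right:
  assumes nn: "\<And>x. 0 \<le> f x" and f: "has_bochner_integral lborel f (1::real)"
    and mean: "has_bochner_integral lborel (\<lambda>x. x * f x) (0::real)"
  shows "\<exists>x>0. 0 < f x"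
proof (rule ccontr)
  assume "\<not> (\<exists>x>0. 0 < f x)"
  hence z: "f x = 0" if "0 < x" for x using that nn[of x] by (force simp: order_le_less)
  have "integrable lborel (\<lambda>x. - (x * f x))" "(\<integral>x. - (x * f x) \<partial>lborel) = 0"
    using mean by (auto simp: has_bochner_integral_iff)
  moreover have "AE x in lborel. 0 \<le> - (x * f x)"
    by (rule AE_I2) (metis mult_nonpos_nonneg neg_0_le_iff_le nn not_le z mult_zero_right order_refl)
  ultimately have "AE x in lborel. - (x * f x) = 0"
    using integral_nonneg_eq_0_iff_AE by blast
  moreover have "AE x in lborel. x \<noteq> (0::real)" by (rule AE_lborel_singleton)
  ultimately have "AE x in lborel. f x = 0" by eventually_elim auto
  hence "integral\<^sup>L lborel f = 0" by (rule integral_eq_zero_AE)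
  thus False using f by (simp add: has_bochner_integral_iff)
qed

text \<open>
  Let \<open>e x = f 0 * exp (- l * x)\<close>; the assumption on the half-line mass says that \<open>f\<close> and \<open>e\<close> have
  equal integrals over \<open>[0, \<infinity>)\<close>. The quotient \<open>f / e\<close> is log-concave and equals one at \<open>0\<close>.
  Having equal integrals, \<open>f\<close> must reach \<open>e\<close> somewhere to the right of \<open>0\<close>; therefore the quotient
  is at most one to the left of \<open>0\<close>, while on the right it is at least one up to some point \<open>\<sigma>\<close> and
  less than one beyond it. The inequality between \<open>x\<close> and \<open>\<sigma>\<close> encodes this sign pattern: its
  integral says that \<open>e\<close> has the larger first moment. It can only be claimed almost everywhere since
  \<open>f\<close> may stay above \<open>e\<close> for ever, in which case the two agree almost everywhere and
  \<open>\<sigma> = 0\<close> will do.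
\<close>
lemma exponential_crossing:
  assumes lc: "log_concave f" and f: "integrable lborel f" and f0: "0 < f 0" and l: "0 < l"
    and p: "(LINT x:{0..}|lborel. f x) = f 0 / l"
  obtains \<sigma> where "0 \<le> \<sigma>"
    "AE x in lborel. 0 \<le> x \<longrightarrow> x * (f x - f 0 * exp (- l * x)) \<le> \<sigma> * (f x - f 0 * exp (- l * x))"
    "\<forall>x<0. f x \<le> f 0 * exp (- l * x)"
proof -
  define e where "e x = f 0 * exp (- l * x)" for x
  define g where "g x = f x * exp (l * x)" for x
  define A where "A = {x. 0 < x \<and> e x \<le> f x}"
  have g: "log_concave g" unfolding g_def using lc by (rule log_concave_exp_tilt)
  have g0: "g 0 = f 0" by (simp add: g_def)
  have fe: "e x \<le> f x \<longleftrightarrow> g 0 \<le> g x" "f x \<le> e x \<longleftrightarrow> g x \<le> g 0" for x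
    by (simp_all add: e_def g_def exp_minus field_simps)
  have D: "has_bochner_integral lborel (\<lambda>x. f 0 / l * exponential_density l x) (f 0 / l * 1)"
    using exponential_moments(1)[OF l] by (rule has_bochner_integral_mult_right)
  have De: "f 0 / l * exponential_density l x = indicator {0..} x * e x" for x
    using l by (simp add: exponential_density_def e_def mult_ac split: split_indicator)
  have F: "has_bochner_integral lborel (\<lambda>x. indicator {0..} x * f x) (f 0 / l)"
    using p integrable_mult_indicator[OF _ f, of "{0..}"]
    by (simp add: has_bochner_integral_iff set_lebesgue_integral_def)
  have d: "has_bochner_integral lborel (\<lambda>x. indicator {0..} x * (f x - e x)) 0"
    using has_bochner_integral_diff[OF F D] unfolding De by (simp add: right_diff_distrib)
  have below: "e y \<le> f y" if "x \<in> A" "0 \<le> y" "y \<le> x" for x y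
    using that fe log_concave_quasiconcave[OF g, of 0 y x "g 0"] by (auto simp: A_def)
  have eq: "AE x in lborel. 0 < x \<longrightarrow> f x = e x"
    if same: "(\<forall>x>0. e x \<le> f x) \<or> (\<forall>x>0. f x \<le> e x)"
  proof -
    have ex: "f 0 = e 0" by (simp add: e_def)
    have "AE x in lborel. indicator {0..} x * (f x - e x) = 0"
      using same
    proof
      assume *: "\<forall>x>0. e x \<le> f x"
      have "0 \<le> indicator {0..} x * (f x - e x)" for x
        using * ex by (cases "x = 0") (auto split: split_indicator)
      thus ?thesis using d integral_nonneg_eq_0_iff_AE[of lborel "\<lambda>x. indicator {0..} x * (f x - e x)"]
        by (auto simp: has_bochner_integral_iff)
    next
      assume *: "\<forall>x>0. f x \<le> e x"
      have "0 \<le> - (indicator {0..} x * (f x - e x))" for x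
        using * ex by (cases "x = 0") (auto split: split_indicator)
      thus ?thesis using d integral_nonneg_eq_0_iff_AE[of lborel "\<lambda>x. - (indicator {0..} x * (f x - e x))"]
        by (auto simp: has_bochner_integral_iff)
    qed
    thus ?thesis by eventually_elim (auto split: split_indicator_asm)
  qed
  \<comment> \<open>If \<open>f\<close> never reached \<open>e\<close>, its integral over the half-line would be strictly smaller.\<close>
  have "A \<noteq> {}"
  proof
    assume "A = {}"
    hence lt: "f x < e x" if "0 < x" for x using that by (force simp: A_def)
    hence "AE x in lborel. 0 < x \<longrightarrow> f x = e x" by (intro eq) (simp add: less_imp_le)
    hence "AE x in lborel. x \<notin> {0<..<1::real}"
      by eventually_elim (use lt in force)
    hence "{0<..<1::real} \<in> null_sets lborel"
      by (subst AE_iff_null_sets) auto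
    thus False by (simp add: null_sets_def)
  qed
  then obtain s where s: "0 < s" "g 0 \<le> g s" "s \<in> A" by (auto simp: A_def fe)
  have left: "f x \<le> e x" if "x < 0" for x
    using log_concave_le_before_rise[OF g that s(1)] s(2) f0 fe g0 by auto
  show ?thesis
  proof (cases "bdd_above A")
    case True
    have "0 \<le> Sup A" using cSup_upper[OF s(3) True] s(1) by simp
    moreover have "x * (f x - e x) \<le> Sup A * (f x - e x)" if "0 \<le> x" for x
    proof (cases "e x \<le> f x")
      case t: True
      have "x \<le> Sup A"
        using that t cSup_upper[OF _ True, of x] \<open>0 \<le> Sup A\<close> by (cases "x = 0") (auto simp: A_def)
      thus ?thesis using t by (intro mult_right_mono) auto
    next
      case False
      have "Sup A \<le> x"
      proof (rule cSup_least[OF \<open>A \<noteq> {}\<close>])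
        fix y assume "y \<in> A" thus "y \<le> x" using below[of y x] that False by force
      qed
      thus ?thesis using False by (intro mult_right_mono_neg) auto
    qed
    ultimately show ?thesis using left by (intro that[of "Sup A"]) (auto simp: e_def)
  next
    case False
    have "e x \<le> f x" if x: "0 < x" for x
    proof -
      obtain y where "y \<in> A" "x < y" using False by (auto simp: bdd_above_def not_le)
      thus ?thesis using below[of y x] x by simp
    qed
    hence "AE x in lborel. 0 < x \<longrightarrow> f x = e x" by (intro eq) auto
    hence "AE x in lborel. 0 \<le> x \<longrightarrow> x * (f x - e x) \<le> 0 * (f x - e x)"
      by eventually_elim (auto simp: order_le_less)
    thus ?thesis using left by (intro that[of 0]) (auto simp: e_def)
  qed
qed

text \<open>
  Let \<open>p\<close> be the mass in question, \<open>l = f 0 / p\<close> and \<open>T = 1 / l\<close>. The linear function \<open>x + T\<close> is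
  negative before \<open>-T\<close>, where \<open>f\<close> is discarded; on \<open>[-T, 0)\<close> it is nonnegative and \<open>f\<close> lies below the
  exponential; on \<open>[0, \<infinity>)\<close> the exponential has the same mass and the larger first moment. Since
  \<open>f 0 * exp (- l * x)\<close> is \<open>p e\<close> times the exponential density started at \<open>-T\<close>, this yields
  \<open>T \<le> p e T\<close>. This \<open>T\<close> minimises \<open>exp (l * T) / (l * T)\<close>, and equality holds for an
  exponential distribution.
\<close>
lemma centred_log_concave_mass_right_ge:
  assumes lc: "log_concave f" and f: "has_bochner_integral lborel f (1::real)"
    and mean: "has_bochner_integral lborel (\<lambda>x. x * f x) (0::real)" and f0: "0 < f 0"
  shows "exp (-1) \<le> (LINT x:{0..}|lborel. f x)"
proof -
  have nn: "0 \<le> f x" for x using lc by (rule log_concave_nonneg)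
  have fi: "integrable lborel f" "integral\<^sup>L lborel f = 1"
    and xi: "integrable lborel (\<lambda>x. x * f x)" "(\<integral>x. x * f x \<partial>lborel) = 0"
    using f mean by (auto simp: has_bochner_integral_iff)
  define p where "p = (LINT x:{0..}|lborel. f x)"
  have Fi: "integrable lborel (\<lambda>x. indicator {0..} x * f x)"
    using integrable_mult_indicator[OF _ fi(1), of "{0..}"] by simp
  have F: "(\<integral>x. indicator {0..} x * f x \<partial>lborel) = p"
    by (simp add: p_def set_lebesgue_integral_def)
  \<comment> \<open>The density stays above a positive constant between \<open>0\<close> and a positive point of its support.\<close>
  have "0 < p"
  proof -
    obtain b where b: "0 < b" "0 < f b" using centred_density_mass_right[OF nn f mean] by blast
    define m where "m = min (f 0) (f b)"
    have "0 < m" using b f0 by (simp add: m_def)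
    have ge: "m \<le> f x" if "0 \<le> x" "x \<le> b" for x
      by (rule log_concave_quasiconcave[OF lc that]) (auto simp: m_def)
    have "m * b = (\<integral>x. indicator {0..b} x * m \<partial>lborel)" using b by simp
    also have "\<dots> \<le> (\<integral>x. indicator {0..} x * f x \<partial>lborel)"
      using b ge nn by (intro integral_mono Fi) (auto split: split_indicator)
    finally show ?thesis using \<open>0 < m\<close> b F mult_pos_pos[of m b] by linarith
  qed
  define l where "l = f 0 / p"
  define T where "T = 1 / l"
  have l: "0 < l" and T: "0 < T" "l * T = 1" and pl: "p = f 0 / l" "f 0 = p * l"
    using f0 \<open>0 < p\<close> by (auto simp: l_def T_def)
  define D where "D = exponential_density l"
  obtain \<sigma> where s: "0 \<le> \<sigma>"
    "AE x in lborel. 0 \<le> x \<longrightarrow> x * (f x - f 0 * exp (- l * x)) \<le> \<sigma> * (f x - f 0 * exp (- l * x))"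
    "\<forall>x<0. f x \<le> f 0 * exp (- l * x)"
    using exponential_crossing[OF lc fi(1) f0 l pl(1)[unfolded p_def]] .
  have D1: "has_bochner_integral lborel D 1" and D2: "has_bochner_integral lborel (\<lambda>x. x * D x) T"
    using exponential_moments[OF l] by (auto simp: D_def T_def)
  have D3: "has_bochner_integral lborel (\<lambda>x. (x + T) * D (x + T)) T"
    using D2 lborel_has_bochner_integral_real_affine_iff[of 1 "\<lambda>x. x * D x" T T]
    by (simp add: add.commute)
  have L: "has_bochner_integral lborel (\<lambda>x. x * f x + T * f x) T"
    using has_bochner_integral_add[OF mean has_bochner_integral_mult_right[OF f, of T]] by simp
  have "has_bochner_integral lborel (\<lambda>x. indicator {0..} x * f x) p"
    using F Fi by (simp add: has_bochner_integral_iff)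
  from has_bochner_integral_add
      [OF has_bochner_integral_mult_right[OF D3, of "p * exp 1"]
        has_bochner_integral_mult_right
          [OF has_bochner_integral_diff[OF this has_bochner_integral_mult_right[OF D1, of p]], of "\<sigma> + T"]]
  have R: "has_bochner_integral lborel
      (\<lambda>x. p * exp 1 * ((x + T) * D (x + T)) + (\<sigma> + T) * (indicator {0..} x * f x - p * D x)) (p * exp 1 * T)"
    by simp
  have Dx: "p * D x = indicator {0..} x * (f 0 * exp (- l * x))" for x
    using l pl by (simp add: D_def exponential_density_def mult_ac split: split_indicator)
  have DT: "p * exp 1 * D (x + T) = indicator {-T..} x * (f 0 * exp (- l * x))" for x
  proof (cases "x < - T")
    case False
    have "exp 1 * exp (- (x + T) * l) = exp (- l * x)"
      using T by (simp add: algebra_simps flip: exp_add)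
    moreover have "p * exp 1 * D (x + T) = f 0 * (exp 1 * exp (- (x + T) * l))"
      using False pl by (simp add: D_def exponential_density_def mult_ac)
    ultimately show ?thesis using False by simp
  qed (simp add: D_def exponential_density_def)
  \<comment> \<open>The last summand integrates to zero; its factor \<open>\<sigma> + T\<close> is the value of \<open>x + T\<close> at the point
    where \<open>f\<close> crosses the exponential.\<close>
  have "AE x in lborel. x * f x + T * f x
      \<le> p * exp 1 * ((x + T) * D (x + T)) + (\<sigma> + T) * (indicator {0..} x * f x - p * D x)"
    using s(2)
  proof eventually_elim
    case (elim x)
    define e where "e = f 0 * exp (- l * x)"
    have eq: "p * exp 1 * ((x + T) * D (x + T)) = (x + T) * (indicator {-T..} x * e)"
      using DT[of x] by (simp add: e_def mult_ac)
    consider "x < - T" | "- T \<le> x" "x < 0" | "0 \<le> x" by linarith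
    thus ?case
    proof cases
      case 1
      have "(x + T) * f x \<le> 0" using 1 nn[of x] by (intro mult_nonpos_nonneg) auto
      thus ?thesis unfolding eq Dx using 1 T by (simp add: algebra_simps)
    next
      case 2
      have "(x + T) * f x \<le> (x + T) * e"
        using 2 s(3) by (intro mult_left_mono) (auto simp: e_def)
      thus ?thesis unfolding eq Dx using 2 by (simp add: algebra_simps)
    next
      case 3
      have "x * (f x - e) \<le> \<sigma> * (f x - e)" using elim 3 by (simp add: e_def)
      thus ?thesis unfolding eq Dx e_def[symmetric] using 3 T by (simp add: algebra_simps)
    qed
  qed
  from integral_mono_AE[OF integrable.intros[OF L] integrable.intros[OF R] this]
  have "T \<le> p * exp 1 * T"
    unfolding has_bochner_integral_integral_eq[OF L] has_bochner_integral_integral_eq[OF R] .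
  hence "1 \<le> p * exp 1" using T by simp
  thus ?thesis unfolding p_def[symmetric] by (simp add: exp_minus field_simps)
qed

section \<open>Mass of short intervals\<close>

lemma set_integral_lborel_shift:
  fixes f :: "real \<Rightarrow> real"
  shows "(LINT x:{a + d..<b + d}|lborel. f x) = (LINT x:{a..<b}|lborel. f (x + d))"
proof -
  have "(LINT x:{a + d..<b + d}|lborel. f x)
      = (\<integral>x. indicator {a + d..<b + d} (d + x) *\<^sub>R f (d + x) \<partial>lborel)"
    unfolding set_lebesgue_integral_def
    using lborel_integral_real_affine[of 1 "\<lambda>x. indicator {a + d..<b + d} x *\<^sub>R f x" d] by simp
  also have "\<dots> = (LINT x:{a..<b}|lborel. f (x + d))"
    unfolding set_lebesgue_integral_def
    by (intro Bochner_Integration.integral_cong) (auto simp: add.commute split: split_indicator)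
  finally show ?thesis .
qed

text \<open>
  Removing the first interval of length \<open>d\<close> and translating the rest back by \<open>d\<close> does not decrease
  the mass of the rest.
\<close>
lemma interval_mass_subadditive:
  fixes f :: "real \<Rightarrow> real"
  assumes f: "integrable lborel f" and "0 \<le> d"
    and shift: "\<And>x. 0 \<le> x \<Longrightarrow> f (x + d) \<le> f x"
  shows "(LINT x:{0..<of_nat k * d}|lborel. f x) \<le> of_nat k * (LINT x:{0..<d}|lborel. f x)"
proof (induction k)
  case (Suc k)
  have si: "set_integrable lborel A g" if "A \<in> sets borel" "integrable lborel g" for A and g :: "real \<Rightarrow> real"
    using integrable_mult_indicator[of A lborel g] that by (simp add: set_integrable_def)
  have fd: "integrable lborel (\<lambda>x. f (x + d))"
    using lborel_integrable_real_affine[OF f, of 1 d] by (simp add: add.commute)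
  have "{0..<d} \<union> {d..<of_nat k * d + d} = {0..<of_nat k * d + d}"
    using \<open>0 \<le> d\<close> by (intro ivl_disj_un_two(3)) auto
  hence "{0..<of_nat (Suc k) * d} = {0..<d} \<union> {0 + d..<of_nat k * d + d}"
    by (simp add: algebra_simps)
  hence "(LINT x:{0..<of_nat (Suc k) * d}|lborel. f x)
      = (LINT x:{0..<d}|lborel. f x) + (LINT x:{0 + d..<of_nat k * d + d}|lborel. f x)"
    by (simp only:) (intro set_integral_Un si f, auto)
  also have "(LINT x:{0 + d..<of_nat k * d + d}|lborel. f x)
      = (LINT x:{0..<of_nat k * d}|lborel. f (x + d))" by (rule set_integral_lborel_shift)
  also have "\<dots> \<le> (LINT x:{0..<of_nat k * d}|lborel. f x)"
    by (intro set_integral_mono si f fd) (auto intro: shift)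
  finally show ?case using Suc by (simp add: algebra_simps)
qed (simp add: set_lebesgue_integral_def)

text \<open>
  Either \<open>f d \<le> f 0\<close>, and the masses of consecutive intervals of length \<open>d\<close> decrease, so that the
  first one has at least its share of the mass of \<open>[0, w)\<close>; or \<open>f 0 < f d\<close>, and \<open>f 0\<close> bounds \<open>f\<close>
  from above on \<open>[-w, 0)\<close> and from below on \<open>[0, d)\<close>, so that the mass on the left gives the
  estimate \<open>m \<le> f 0 * w\<close>.
\<close>
lemma log_concave_interval_mass_ge:
  assumes lc: "log_concave f" and f: "integrable lborel f" and f0: "0 < f 0" and d: "0 < d"
    and right: "m \<le> (LINT x:{0..<w}|lborel. f x)" and left: "m \<le> (LINT x:{-w..<0}|lborel. f x)"
    and m: "0 \<le> m" and w: "0 < w"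
  shows "m * d / (w + d) \<le> (LINT x:{0..<d}|lborel. f x)"
proof -
  have nn: "0 \<le> f x" for x using lc by (rule log_concave_nonneg)
  have si: "set_integrable lborel A f" if "A \<in> sets borel" for A
    using integrable_mult_indicator[of A lborel f] f that by (simp add: set_integrable_def)
  have const: "set_integrable lborel {a..<b} (\<lambda>x. c)" "(LINT x:{a..<b}|lborel. c) = c * (b - a)"
    if "a \<le> b" for a b c :: real
    using that by (auto simp: set_integrable_def set_lebesgue_integral_def)
  define G where "G = (LINT x:{0..<d}|lborel. f x)"
  show ?thesis
  proof (cases "f d \<le> f 0")
    case True
    have shift: "f (x + d) \<le> f x" if "0 \<le> x" for x
    proof -
      have "f 0 * f (x + d) \<le> f d * f x"
        using log_concave_exchange[OF lc that, of d] d by simp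
      also have "\<dots> \<le> f 0 * f x" using True nn by (intro mult_right_mono)
      finally show ?thesis using f0 by simp
    qed
    \<comment> \<open>The least number of intervals of length \<open>d\<close> that cover \<open>[0, w)\<close>.\<close>
    define k where "k = nat \<lceil>w / d\<rceil>"
    have k: "w / d \<le> of_nat k" "of_nat k \<le> w / d + 1"
      using d w by (auto simp: k_def of_nat_ceiling)
    have "0 \<le> G" unfolding G_def set_lebesgue_integral_def
      by (intro integral_nonneg_AE) (auto simp: nn)
    have "m \<le> (LINT x:{0..<w}|lborel. f x)" by (rule right)
    also have "\<dots> \<le> (LINT x:{0..<of_nat k * d}|lborel. f x)"
    proof -
      have "w \<le> of_nat k * d" using k(1) d by (simp add: field_simps)
      thus ?thesis unfolding set_lebesgue_integral_def
        by (intro integral_mono si[unfolded set_integrable_def]) (auto simp: nn split: split_indicator)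
    qed
    also have "\<dots> \<le> of_nat k * G"
      unfolding G_def using d by (intro interval_mass_subadditive f shift) auto
    also have "\<dots> \<le> (w / d + 1) * G" using k(2) \<open>0 \<le> G\<close> by (rule mult_right_mono)
    finally show ?thesis unfolding G_def[symmetric] using d w by (simp add: field_simps)
  next
    case False
    have above: "f 0 \<le> f x" if "x \<in> {0..<d}" for x
      using that False by (intro log_concave_quasiconcave[OF lc, of 0 x d]) auto
    have below: "f x \<le> f 0" if "x \<in> {-w..<0}" for x
      using that False d f0 by (intro log_concave_le_before_rise[OF lc, of x 0 d]) auto
    have "m \<le> (LINT x:{-w..<0}|lborel. f x)" by (rule left)
    also have "\<dots> \<le> (LINT x:{-w..<0}|lborel. f 0)"
      using w by (intro set_integral_mono si const below) auto
    also have "\<dots> = f 0 * w" using const(2)[of "-w" 0 "f 0"] w by simp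
    finally have mw: "m \<le> f 0 * w" .
    have "m * d \<le> f 0 * w * d" using mw d by (intro mult_right_mono) auto
    also have "\<dots> \<le> f 0 * d * (w + d)" using f0 d by (simp add: algebra_simps)
    finally have "m * d / (w + d) \<le> f 0 * d" using d w by (simp add: divide_le_eq)
    also have "\<dots> = (LINT x:{0..<d}|lborel. f 0)" using const(2)[of 0 d "f 0"] d by simp
    also have "\<dots> \<le> (LINT x:{0..<d}|lborel. f x)"
      using d by (intro set_integral_mono si const above) auto
    finally show ?thesis .
  qed
qed

theorem theorem1p1:
  fixes M :: "'a measure" and X :: "'a \<Rightarrow> real" and \<delta> :: real
  assumes "in_L M X" and "\<delta> > 0"
  shows "\<P>(\<omega> in M. 0 < X \<omega> \<and> X \<omega> < \<delta>) \<ge> \<delta> / (72 * (1 + (419 / 100) * \<delta>))"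
proof -
  interpret prob_space M using assms(1) by (simp add: in_L_def)
  obtain f where lc: "log_concave f" and D: "distributed M lborel X (\<lambda>x. ennreal (f x))"
    using assms(1) by (auto simp: in_L_def)
  have X: "integrable M X" "expectation X = 0" "integrable M (\<lambda>\<omega>. (X \<omega>)\<^sup>2)" "expectation (\<lambda>\<omega>. (X \<omega>)\<^sup>2) = 1"
    using assms(1) by (auto simp: in_L_def)
  have nn: "0 \<le> f x" for x using lc by (rule log_concave_nonneg)
  have Xm [measurable]: "X \<in> borel_measurable M"
    using distributed_measurable[OF D] by simp
  have transfer: "has_bochner_integral lborel (\<lambda>x. g x * f x) (expectation (\<lambda>\<omega>. g (X \<omega>)))"
    if "g \<in> borel_measurable borel" "integrable M (\<lambda>\<omega>. g (X \<omega>))" for g :: "real \<Rightarrow> real"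
    using that distributed_integral[OF D, of g] distributed_integrable[OF D, of g] nn
    by (simp add: has_bochner_integral_iff mult.commute)
  have f: "has_bochner_integral lborel f 1"
    using transfer[OF borel_measurable_const[of 1]] by (simp add: prob_space)
  have mean: "has_bochner_integral lborel (\<lambda>x. x * f x) 0"
    using transfer[of "\<lambda>x. x", OF _ X(1)] by (simp add: X(2))
  have fi: "integrable lborel f" using f by (simp add: has_bochner_integral_iff)
  have pr: "(LINT x:A|lborel. f x) = \<P>(\<omega> in M. X \<omega> \<in> A)" if [measurable]: "A \<in> sets borel" for A
  proof -
    have ind: "indicator A (X \<omega>) = (indicator (X -` A) \<omega> :: real)" for \<omega> by (simp add: indicator_def)
    have "(\<integral>\<omega>. indicator A (X \<omega>) \<partial>M) = prob (X -` A \<inter> space M)"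
      unfolding ind by (simp add: Int_commute)
    also have "X -` A \<inter> space M = {\<omega> \<in> space M. X \<omega> \<in> A}" by auto
    finally have E: "(\<integral>\<omega>. indicator A (X \<omega>) \<partial>M) = \<P>(\<omega> in M. X \<omega> \<in> A)" .
    show ?thesis
      using distributed_integral[OF D, of "indicator A"] nn
      by (simp add: E set_lebesgue_integral_def mult.commute)
  qed
  define h where "h x = f (- x)" for x
  have refl: "has_bochner_integral lborel (\<lambda>x. g (- x)) c" if "has_bochner_integral lborel g c"
    for g :: "real \<Rightarrow> real" and c
    using that lborel_has_bochner_integral_real_affine_iff[of "-1" g c 0] by simp
  have h: "log_concave h" "has_bochner_integral lborel h 1" "has_bochner_integral lborel (\<lambda>x. x * h x) 0"
    using log_concave_reflect[OF lc] refl[OF f] has_bochner_integral_minus[OF refl[OF mean]]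
    by (simp_all add: h_def[abs_def])
  have f0: "0 < f 0"
  proof -
    obtain b where b: "0 < b" "0 < f b" using centred_density_mass_right[OF nn f mean] by blast
    obtain a where a: "0 < a" "0 < f (- a)"
      using centred_density_mass_right[OF log_concave_nonneg[OF h(1)] h(2,3)] by (auto simp: h_def)
    have "min (f (- a)) (f b) \<le> f 0"
      using a b by (intro log_concave_quasiconcave[OF lc, of "-a" 0 b]) auto
    thus ?thesis using a b by linarith
  qed
  \<comment> \<open>Gruenbaum's bound, weakened to a rational number that still exceeds the \<open>1/4\<close> lost to
    Chebyshev's inequality.\<close>
  have third: "1 / 3 \<le> exp (-1 :: real)" using exp_le by (simp add: exp_minus field_simps)
  have right: "1 / 3 \<le> \<P>(\<omega> in M. 0 \<le> X \<omega>)"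
    using centred_log_concave_mass_right_ge[OF lc f mean f0] third by (simp add: pr)
  have "(LINT x:{0..}|lborel. h x) = (LINT x:{..0}|lborel. f x)"
    unfolding set_lebesgue_integral_def h_def
    using lborel_integral_real_affine[of "-1" "\<lambda>x. indicator {..0} x *\<^sub>R f x" 0]
    by (simp add: indicator_def)
  hence left: "1 / 3 \<le> \<P>(\<omega> in M. X \<omega> \<le> 0)"
    using centred_log_concave_mass_right_ge[OF h] third f0 by (simp add: pr h_def)
  have null: "\<P>(\<omega> in M. X \<omega> = 0) = 0"
  proof -
    have "AE x in lborel. indicator {0} x *\<^sub>R f x = 0"
      using AE_lborel_singleton[of "0::real"] by eventually_elim simp
    hence "(LINT x:{0}|lborel. f x) = 0"
      unfolding set_lebesgue_integral_def by (rule integral_eq_zero_AE)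
    thus ?thesis using pr[of "{0}"] by simp
  qed
  have cheb: "\<P>(\<omega> in M. 2 \<le> \<bar>X \<omega>\<bar>) \<le> 1 / 4"
    using Chebyshev_inequality[OF Xm X(3), of 2] X(2,4) by simp
  have "\<P>(\<omega> in M. 0 \<le> X \<omega>) \<le> \<P>(\<omega> in M. X \<omega> \<in> {0..<2}) + \<P>(\<omega> in M. 2 \<le> \<bar>X \<omega>\<bar>)"
    by (rule order_trans[OF finite_measure_mono measure_Un_le]) auto
  hence R: "1 / 12 \<le> (LINT x:{0..<2}|lborel. f x)" using right cheb by (simp add: pr)
  have "\<P>(\<omega> in M. X \<omega> \<le> 0)
      \<le> \<P>(\<omega> in M. X \<omega> \<in> {-2..<0}) + \<P>(\<omega> in M. X \<omega> = 0 \<or> 2 \<le> \<bar>X \<omega>\<bar>)"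
    by (rule order_trans[OF finite_measure_mono measure_Un_le]) auto
  moreover have "\<P>(\<omega> in M. X \<omega> = 0 \<or> 2 \<le> \<bar>X \<omega>\<bar>) \<le> \<P>(\<omega> in M. X \<omega> = 0) + \<P>(\<omega> in M. 2 \<le> \<bar>X \<omega>\<bar>)"
    by (rule order_trans[OF finite_measure_mono measure_Un_le]) auto
  ultimately have L: "1 / 12 \<le> (LINT x:{-2..<0}|lborel. f x)" using left cheb null by (simp add: pr)
  have "\<P>(\<omega> in M. X \<omega> \<in> {0..<\<delta>}) \<le> \<P>(\<omega> in M. 0 < X \<omega> \<and> X \<omega> < \<delta>) + \<P>(\<omega> in M. X \<omega> = 0)"
    by (rule order_trans[OF finite_measure_mono measure_Un_le]) auto
  hence "1 / 12 * \<delta> / (2 + \<delta>) \<le> \<P>(\<omega> in M. 0 < X \<omega> \<and> X \<omega> < \<delta>)"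
    using log_concave_interval_mass_ge[OF lc fi f0 assms(2) R L] null by (simp add: pr)
  moreover have "\<delta> / (72 * (1 + (419 / 100) * \<delta>)) \<le> 1 / 12 * \<delta> / (2 + \<delta>)"
    using assms(2) by (simp add: frac_le)
  ultimately show ?thesis by linarith
qed

end
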